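(* For every integer $k\ge1$: (a) $H_k\,\varphi^k(1)\,H_k = 2^k\operatorname{diag}\big(J_{k+1},\,J_k,\,J_{k-1}\rho^1(1),\,J_{k-2}\rho^2(1),\,\dots,\,J_1\rho^{k-1}(1)\big)$; (b) $H_k\,\varphi^k(0)\,H_k = 2^{k+1}\operatorname{diag}\big(J_{k},\,J_{k-1},\,J_{k-2}\rho^1(1),\,\dots,\,J_1\rho^{k-2}(1),\,J_0\rho^{k-1}(1)\big)$. Here the argument of $\operatorname{diag}$ is the concatenation (a vector of length $2^k$) of the listed scalars and scaled vectors; in (a) the terms are $J_{k+1}$, $J_k$, and $J_{k-m}\rho^m(1)$ for $m=1,\dots,k-1$; in (b) they are $J_k$, $J_{k-1}$, and $J_{k-1-m}\rho^m(1)$ for $m=1,\dots,k-1$.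
   Context: $J_n=(2^n-(-1)^n)/3$ are the Jacobsthal numbers. $H_k=\gamma^k(1)$ is the $2^k\times2^k$ Hadamard matrix defined by $H_0=[1]$ and $H_{k+1}=\begin{bmatrix}H_k&H_k\\H_k&-H_k\end{bmatrix}$. The $2^k\times 2^k$ matrices $\varphi^k(1),\varphi^k(0)$ are defined by $\varphi^0(1)=[1]$, $\varphi^0(0)=[0]$ and $\varphi^{k+1}(1)=\begin{bmatrix}\varphi^k(1)&\varphi^k(0)\\\varphi^k(0)&\varphi^k(1)\end{bmatrix}$, $\varphi^{k+1}(0)=\begin{bmatrix}\varphi^k(1)&\varphi^k(1)\\\varphi^k(1)&\varphi^k(1)\end{bmatrix}$ (iterates of the 2-D morphism $1\mapsto\begin{bmatrix}1&0\\0&1\end{bmatrix}$, $0\mapsto\begin{bmatrix}1&1\\1&1\end{bmatrix}$). The vectors $\rho^m(1)\in\{\pm1\}^{2^m}$ are iterates of the morphism $\rho(1)=(-1,1)$, $\rho(-1)=(1,-1)$: $\rho^0(1)=(1)$ and $\rho^{m+1}(1)$ is obtained by replacing each entry $x$ of $\rho^m(1)$ by $\rho(x)$ and concatenating (e.g. $\rho^2(1)=(1,-1,-1,1)$). For a vector $v=(a_1,\dots,a_n)$, $\operatorname{diag}(v)$ is the diagonal matrix with diagonal entries $a_1,\dots,a_n$. *)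

theory Defs
  imports "Jordan_Normal_Form.Matrix" Complex_Main
begin

definition jacobsthal :: "nat \<Rightarrow> real" where
  "jacobsthal n = (2 ^ n - (-1) ^ n) / 3"

fun hadamard :: "nat \<Rightarrow> real mat" where
  "hadamard 0 = mat 1 1 (\<lambda>_. 1)"
| "hadamard (Suc k) =
     four_block_mat (hadamard k) (hadamard k) (hadamard k) (- hadamard k)"

text \<open>\<^term>\<open>phi1 k\<close> and \<^term>\<open>phi0 k\<close> are the \<open>k\<close>-th iterates of the two-dimensional
  morphism \<open>1 \<mapsto> [1 0; 0 1]\<close>, \<open>0 \<mapsto> [1 1; 1 1]\<close> on the letters 1 and 0.\<close>

fun phi1 :: "nat \<Rightarrow> real mat" and phi0 :: "nat \<Rightarrow> real mat" where
  "phi1 0 = mat 1 1 (\<lambda>_. 1)"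
| "phi1 (Suc k) = four_block_mat (phi1 k) (phi0 k) (phi0 k) (phi1 k)"
| "phi0 0 = mat 1 1 (\<lambda>_. 0)"
| "phi0 (Suc k) = four_block_mat (phi1 k) (phi1 k) (phi1 k) (phi1 k)"

text \<open>On the alphabet \<open>{1, -1}\<close> the morphism \<open>1 \<mapsto> (-1, 1)\<close>, \<open>-1 \<mapsto> (1, -1)\<close> is
  \<open>x \<mapsto> (-x, x)\<close>.\<close>

fun rho_iter :: "nat \<Rightarrow> real list" where
  "rho_iter 0 = [1]"
| "rho_iter (Suc m) = concat (map (\<lambda>x. [- x, x]) (rho_iter m))"

definition scale :: "real \<Rightarrow> real list \<Rightarrow> real list" where
  "scale c v = map (\<lambda>x. c * x) v"

definition diag :: "real list \<Rightarrow> real mat" where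
  "diag v = mat_diag (length v) (\<lambda>i. v ! i)"

lemma hadamard_carrier: "hadamard k \<in> carrier_mat (2 ^ k) (2 ^ k)"
proof (induction k)
  case (Suc k)
  then show ?case
    using four_block_carrier_mat[of "hadamard k" "2 ^ k" "2 ^ k" "- hadamard k" "2 ^ k" "2 ^ k"]
    by (simp add: mult_2)
qed simp

lemma phi_carrier:
  "phi1 k \<in> carrier_mat (2 ^ k) (2 ^ k)" "phi0 k \<in> carrier_mat (2 ^ k) (2 ^ k)"
proof (induction k)
  case (Suc k)
  { case 1
    show ?case
      using Suc four_block_carrier_mat[of "phi1 k" "2 ^ k" "2 ^ k" "phi1 k" "2 ^ k" "2 ^ k"]
      by (simp add: mult_2) }
  { case 2
    show ?case
      using Suc four_block_carrier_mat[of "phi1 k" "2 ^ k" "2 ^ k" "phi1 k" "2 ^ k" "2 ^ k"]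
      by (simp add: mult_2) }
qed simp_all

lemma length_rho_iter: "length (rho_iter m) = 2 ^ m"
  by (induction m) (simp_all add: length_concat o_def sum_list_triv)

lemma rho_iter_2: "rho_iter 2 = [1, -1, -1, 1]"
  by (simp add: numeral_2_eq_2)

end

theory Submission
  imports Defs
begin

text \<open>If \<open>P k\<close> and \<open>Q k\<close> denote the conjugates of \<open>phi1 k\<close> and \<open>phi0 k\<close> by \<open>hadamard k\<close>, block
  multiplication gives \<open>P (k+1) = diag(2 (P k + Q k), 2 (P k - Q k))\<close> and
  \<open>Q (k+1) = diag(4 P k, 0)\<close>. The diagonal lists satisfy the same recursion because
  \<open>J (n+2) = J (n+1) + 2 J n\<close> and \<open>J (n+1) - 2 J n = (-1) ^ n\<close>; the latter produces the
  signs in the decomposition of \<open>rho_iter k\<close> into \<open>1, -1\<close> and multiples of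
  \<open>rho_iter m\<close> for \<open>1 \<le> m < k\<close>.\<close>

section \<open>Entrywise list operations and diagonal matrices\<close>

lemma length_scale [simp]: "length (scale c v) = length v"
  by (simp add: scale_def)

lemma scale_append: "scale c (u @ v) = scale c u @ scale c v"
  by (simp add: scale_def)

lemma scale_scale: "scale c (scale d v) = scale (c * d) v"
  by (simp add: scale_def mult.assoc)

lemma map2_add_scale: "map2 (+) (scale c v) (scale d v) = scale (c + d) v"
  by (induction v) (simp_all add: scale_def algebra_simps)

lemma map2_minus_scale: "map2 (-) (scale c v) (scale d v) = scale (c - d) v"
  by (induction v) (simp_all add: scale_def algebra_simps)

lemma diag_carrier: "diag v \<in> carrier_mat (length v) (length v)"
  by (simp add: diag_def)

lemma diag_add:
  assumes "length u = length v"
  shows "diag u + diag v = diag (map2 (+) u v)"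
  using assms by (intro eq_matI) (auto simp: diag_def mat_diag_def)

lemma diag_minus:
  assumes "length u = length v"
  shows "diag u - diag v = diag (map2 (-) u v)"
  using assms by (intro eq_matI) (auto simp: diag_def mat_diag_def)

lemma smult_diag: "c \<cdot>\<^sub>m diag v = diag (scale c v)"
  by (intro eq_matI) (auto simp: diag_def mat_diag_def scale_def)

lemma diag_append:
  "four_block_mat (diag u) (0\<^sub>m (length u) (length v)) (0\<^sub>m (length v) (length u)) (diag v)
    = diag (u @ v)"
  by (intro eq_matI) (auto simp: diag_def mat_diag_def nth_append not_less)

section \<open>Conjugation by Hadamard matrices\<close>

text \<open>Left multiplication turns the block rows into \<open>(S, S)\<close> and
  \<open>(D, - D)\<close> with \<open>S = H * A + H * B\<close> and
  \<open>D = H * A - H * B\<close>; right multiplication then doubles \<open>S * H\<close> and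
  \<open>D * H\<close> on the diagonal and cancels them off it. The shape \<open>A B B A\<close>
  covers both morphism images: \<open>phi0\<close> is the case \<open>A = B\<close>.\<close>

lemma hadamard_conj_four_block:
  assumes A: "A \<in> carrier_mat (2 ^ k) (2 ^ k)" and B: "B \<in> carrier_mat (2 ^ k) (2 ^ k)"
  defines "H \<equiv> hadamard k"
  shows "hadamard (Suc k) * four_block_mat A B B A * hadamard (Suc k)
    = four_block_mat (2 \<cdot>\<^sub>m (H * A * H + H * B * H)) (0\<^sub>m (2 ^ k) (2 ^ k))
        (0\<^sub>m (2 ^ k) (2 ^ k)) (2 \<cdot>\<^sub>m (H * A * H - H * B * H))"
proof -
  have H: "H \<in> carrier_mat (2 ^ k) (2 ^ k)"
    unfolding H_def by (rule hadamard_carrier)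
  note c = A B H
  have HA: "H * A \<in> carrier_mat (2 ^ k) (2 ^ k)" and HB: "H * B \<in> carrier_mat (2 ^ k) (2 ^ k)"
    using c by auto
  let ?S = "H * A + H * B" and ?D = "H * A - H * B"
  let ?X = "H * A * H" and ?Y = "H * B * H"
  have XY: "?X \<in> carrier_mat (2 ^ k) (2 ^ k)" "?Y \<in> carrier_mat (2 ^ k) (2 ^ k)"
    using c by auto
  have nA: "- H * A = - (H * A)" and nB: "- H * B = - (H * B)"
    using c by auto
  have SH: "?S * H = ?X + ?Y"
    using HA HB H by (rule add_mult_distrib_mat)
  have DH: "?D * H = ?X - ?Y"
    using HA HB H by (rule minus_mult_distrib_mat)
  have XYp: "?X + ?Y \<in> carrier_mat (2 ^ k) (2 ^ k)" and XYm: "?X - ?Y \<in> carrier_mat (2 ^ k) (2 ^ k)"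
    using XY minus_carrier_mat[OF XY(2), of ?X] by auto
  have double: "X + X = 2 \<cdot>\<^sub>m X" and cancel: "X + - X = 0\<^sub>m (2 ^ k) (2 ^ k)"
    if "X \<in> carrier_mat (2 ^ k) (2 ^ k)" for X :: "real mat"
    using that by (auto intro!: eq_matI)
  have D: "?D \<in> carrier_mat (2 ^ k) (2 ^ k)" and S: "?S \<in> carrier_mat (2 ^ k) (2 ^ k)"
    and D': "- ?D \<in> carrier_mat (2 ^ k) (2 ^ k)"
    using HA HB minus_carrier_mat[OF HB, of "H * A"] by auto
  have nH: "- H \<in> carrier_mat (2 ^ k) (2 ^ k)"
    using H by auto
  have SnH: "?S * - H = - (?X + ?Y)"
    unfolding SH[symmetric] using S H by auto
  have nDH: "- ?D * H = - (?X - ?Y)"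
    unfolding DH[symmetric] using D H by auto
  have nDnH: "- ?D * - H = ?X - ?Y"
    unfolding DH[symmetric] using D D' H by auto
  have eqs: "Y + X = X + Y" "X + - Y = X - Y" "Y + - X = - (X - Y)"
    if "X \<in> carrier_mat (2 ^ k) (2 ^ k)" "Y \<in> carrier_mat (2 ^ k) (2 ^ k)" for X Y :: "real mat"
    using that by (auto intro!: eq_matI)
  have "hadamard (Suc k) * four_block_mat A B B A
      = four_block_mat (H * A + H * B) (H * B + H * A) (H * A + - H * B) (H * B + - H * A)"
    unfolding hadamard.simps H_def[symmetric] by (rule mult_four_block_mat[OF H H H nH A B B A])
  then have HM: "hadamard (Suc k) * four_block_mat A B B A = four_block_mat ?S ?S ?D (- ?D)"
    unfolding nA nB eqs[OF HA HB] .
  have "four_block_mat ?S ?S ?D (- ?D) * hadamard (Suc k)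
    = four_block_mat (?S * H + ?S * H) (?S * H + ?S * - H)
        (?D * H + - ?D * H) (?D * H + - ?D * - H)"
    unfolding hadamard.simps H_def[symmetric] by (rule mult_four_block_mat[OF S S D D' H H H nH])
  then show ?thesis
    unfolding HM SnH nDH nDnH SH DH double[OF XYp] double[OF XYm] cancel[OF XYp] cancel[OF XYm] .
qed

lemma hadamard_conj_diag:
  assumes A: "A \<in> carrier_mat (2 ^ k) (2 ^ k)" and B: "B \<in> carrier_mat (2 ^ k) (2 ^ k)"
    and u: "hadamard k * A * hadamard k = diag u" and v: "hadamard k * B * hadamard k = diag v"
  shows "hadamard (Suc k) * four_block_mat A B B A * hadamard (Suc k)
    = diag (scale 2 (map2 (+) u v) @ scale 2 (map2 (-) u v))"
proof -
  \<comment> \<open>The product has as many rows as \<open>hadamard k\<close>, which fixes the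
    length of the diagonal list; \<open>diag_add\<close> and \<open>diag_minus\<close> need equal
    lengths.\<close>
  have len: "length w = 2 ^ k" if "hadamard k * C * hadamard k = diag w" for C w
  proof -
    have "dim_row (hadamard k * C * hadamard k) = 2 ^ k"
      using hadamard_carrier[of k] by simp
    then show ?thesis
      unfolding that using diag_carrier[of w] by simp
  qed
  have "length u = 2 ^ k" "length v = 2 ^ k"
    using len u v by blast+
  then show ?thesis
    unfolding hadamard_conj_four_block[OF A B] u v
    by (simp add: diag_add diag_minus smult_diag flip: diag_append)
qed

section \<open>Lists assembled from the iterates of rho\<close>

text \<open>The common shape of both diagonals, with free coefficients, so that sums, differences
  and multiples of such lists become operations on coefficients.\<close>

definition rho_concat :: "real \<Rightarrow> real \<Rightarrow> (nat \<Rightarrow> real) \<Rightarrow> nat \<Rightarrow> real list" where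
  "rho_concat a b f k = [a, b] @ concat (map (\<lambda>m. scale (f m) (rho_iter m)) [1..<k])"

lemma rho_concat_1: "rho_concat a b f (Suc 0) = [a, b]"
  by (simp add: rho_concat_def)

lemma rho_concat_Suc:
  "k \<ge> 1 \<Longrightarrow> rho_concat a b f (Suc k) = rho_concat a b f k @ scale (f k) (rho_iter k)"
  by (simp add: rho_concat_def)

lemma rho_concat_cong:
  assumes "a = a'" "b = b'" "\<And>m. 1 \<le> m \<Longrightarrow> m < k \<Longrightarrow> f m = f' m"
  shows "rho_concat a b f k = rho_concat a' b' f' k"
proof -
  have "map (\<lambda>m. scale (f m) (rho_iter m)) [1..<k] = map (\<lambda>m. scale (f' m) (rho_iter m)) [1..<k]"
    using assms(3) by simp
  then show ?thesis
    unfolding rho_concat_def assms(1,2) by argo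
qed

lemma length_rho_concat: "k \<ge> 1 \<Longrightarrow> length (rho_concat a b f k) = 2 ^ k"
  by (induction k rule: dec_induct) (simp_all add: rho_concat_1 rho_concat_Suc length_rho_iter)

lemma scale_rho_concat:
  "k \<ge> 1 \<Longrightarrow> scale c (rho_concat a b f k) = rho_concat (c * a) (c * b) (\<lambda>m. c * f m) k"
  by (induction k rule: dec_induct)
    (simp_all add: rho_concat_1 rho_concat_Suc scale_append scale_scale, simp add: scale_def)

lemma map2_add_rho_concat:
  "k \<ge> 1 \<Longrightarrow> map2 (+) (rho_concat a b f k) (rho_concat a' b' f' k)
    = rho_concat (a + a') (b + b') (\<lambda>m. f m + f' m) k"
  by (induction k rule: dec_induct)
    (simp_all add: rho_concat_1 rho_concat_Suc length_rho_concat map2_add_scale)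

lemma map2_minus_rho_concat:
  "k \<ge> 1 \<Longrightarrow> map2 (-) (rho_concat a b f k) (rho_concat a' b' f' k)
    = rho_concat (a - a') (b - b') (\<lambda>m. f m - f' m) k"
  by (induction k rule: dec_induct)
    (simp_all add: rho_concat_1 rho_concat_Suc length_rho_concat map2_minus_scale)

text \<open>The morphism commutes with negation and concatenation, so letterwise substitution can be
  traded for a recursion on halves, the form that matches \<open>rho_concat_Suc\<close>.\<close>

lemma rho_iter_Suc_append: "rho_iter (Suc m) = scale (-1) (rho_iter m) @ rho_iter m"
proof (induction m)
  case (Suc m)
  have "rho_iter (Suc (Suc m))
      = concat (map (\<lambda>x. [- x, x]) (scale (-1) (rho_iter m) @ rho_iter m))"
    by (subst rho_iter.simps(2), subst Suc.IH) (rule refl)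
  also have "\<dots> = scale (-1) (rho_iter (Suc m)) @ rho_iter (Suc m)"
    by (simp add: scale_def map_concat o_def)
  finally show ?case .
qed (simp add: scale_def)

text \<open>Unrolling the recursion on halves: each step negates all earlier coefficients and
  appends one block with coefficient 1. This later identifies a list of alternating signs as
  \<open>rho_iter k\<close>.\<close>

lemma rho_iter_eq_rho_concat:
  assumes "k \<ge> 1"
  shows "rho_iter k = rho_concat ((-1) ^ k) (- ((-1) ^ k)) (\<lambda>m. - ((-1) ^ (k + m))) k"
  using assms
proof (induction k rule: dec_induct)
  case (step k)
  have "rho_iter (Suc k) = scale (-1) (rho_iter k) @ scale 1 (rho_iter k)"
    by (simp only: rho_iter_Suc_append) (simp add: scale_def)
  also have "scale (-1) (rho_iter k)
      = rho_concat ((-1) ^ Suc k) (- ((-1) ^ Suc k)) (\<lambda>m. - ((-1) ^ (Suc k + m))) k"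
    by (subst step.IH) (use step.hyps in \<open>simp add: scale_rho_concat\<close>)
  \<comment> \<open>The exponent is odd, so 1 is the value of the coefficient function for
    \<open>Suc k\<close> at \<open>m = k\<close>.\<close>
  also have "scale 1 (rho_iter k) = scale (- ((-1) ^ (Suc k + k))) (rho_iter k)"
    by (simp flip: mult_2)
  finally show ?case
    using step.hyps by (simp only: rho_concat_Suc)
qed (simp add: rho_concat_1)

section \<open>Jacobsthal numbers and the recursion of the diagonals\<close>

lemma jacobsthal_0: "jacobsthal 0 = 0" and jacobsthal_1: "jacobsthal (Suc 0) = 1"
  by (simp_all add: jacobsthal_def)

lemma jacobsthal_rec: "jacobsthal (Suc (Suc n)) = jacobsthal (Suc n) + 2 * jacobsthal n"
  by (simp add: jacobsthal_def field_simps)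

lemma jacobsthal_Suc_diff: "jacobsthal (Suc n) - 2 * jacobsthal n = (-1) ^ n"
  by (simp add: jacobsthal_def field_simps)

text \<open>The decomposition of \<open>rho_iter k\<close> multiplied by zero. It lets the vanishing
  lower block of the conjugate of \<open>phi0 (Suc k)\<close> be read as a multiple of
  \<open>rho_iter k\<close>.\<close>

lemma rho_concat_zero: "k \<ge> 1 \<Longrightarrow> rho_concat 0 0 (\<lambda>_. 0) k = scale 0 (rho_iter k)"
  by (subst rho_iter_eq_rho_concat) (simp_all add: scale_rho_concat)

definition diag1 :: "nat \<Rightarrow> real list" where
  "diag1 k = rho_concat (jacobsthal (k + 1)) (jacobsthal k) (\<lambda>m. jacobsthal (k - m)) k"

definition diag0 :: "nat \<Rightarrow> real list" where
  "diag0 k = rho_concat (jacobsthal k) (jacobsthal (k - 1)) (\<lambda>m. jacobsthal (k - 1 - m)) k"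

text \<open>The index shift in \<open>diag0\<close> makes its coefficients at \<open>Suc k\<close>
  those of \<open>diag1\<close> at \<open>k\<close>; the one new coefficient is
  \<open>jacobsthal 0 = 0\<close>.\<close>

lemma diag0_Suc:
  assumes "k \<ge> 1"
  shows "diag0 (Suc k) = diag1 k @ scale 0 (rho_iter k)"
  using assms by (simp add: diag0_def diag1_def rho_concat_Suc jacobsthal_0)

text \<open>The factor 2 on \<open>diag0 k\<close> reflects the normalisation by
  \<open>2 ^ (k + 1)\<close> rather than \<open>2 ^ k\<close>. In the sum, the Jacobsthal recurrence
  raises every index by one; in the difference only signs remain, and they are the coefficients of
  \<open>rho_iter k\<close>.\<close>

lemma diag1_Suc:
  assumes "k \<ge> 1"
  shows "diag1 (Suc k) = map2 (+) (diag1 k) (scale 2 (diag0 k))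
    @ map2 (-) (diag1 k) (scale 2 (diag0 k))"
proof -
  obtain n where k: "k = Suc n"
    using assms by (cases k) auto
  have J: "jacobsthal (Suc k - m) = jacobsthal (k - m) + 2 * jacobsthal (k - 1 - m)"
    "- ((-1) ^ (k + m)) = jacobsthal (k - m) - 2 * jacobsthal (k - 1 - m)" if "m < k" for m
  proof -
    \<comment> \<open>This form removes the truncated subtractions, and
      \<open>k + m = 2 * m + d + 1\<close> gives the sign \<open>(-1) ^ d\<close>.\<close>
    obtain d where d: "k = Suc (m + d)"
      using less_imp_Suc_add \<open>m < k\<close> by blast
    have "- ((-1) ^ (k + m)) = (-1 :: real) ^ d"
      by (simp add: d power_add flip: power_mult_distrib)
    then show "- ((-1) ^ (k + m)) = jacobsthal (k - m) - 2 * jacobsthal (k - 1 - m)"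
      using jacobsthal_Suc_diff[of d] by (simp add: d)
    show "jacobsthal (Suc k - m) = jacobsthal (k - m) + 2 * jacobsthal (k - 1 - m)"
      using jacobsthal_rec[of d] by (simp add: d Suc_diff_le)
  qed
  have "map2 (+) (diag1 k) (scale 2 (diag0 k))
    = rho_concat (jacobsthal (Suc k + 1)) (jacobsthal (Suc k)) (\<lambda>m. jacobsthal (Suc k - m)) k"
    unfolding diag1_def diag0_def scale_rho_concat[OF assms] map2_add_rho_concat[OF assms]
    using J(1) by (intro rho_concat_cong) (simp_all add: k jacobsthal_rec)
  moreover have "map2 (-) (diag1 k) (scale 2 (diag0 k)) = rho_iter k"
    unfolding diag1_def diag0_def scale_rho_concat[OF assms] map2_minus_rho_concat[OF assms]
      rho_iter_eq_rho_concat[OF assms]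
    using J(2) jacobsthal_Suc_diff[of k] jacobsthal_Suc_diff[of n]
    by (intro rho_concat_cong) (simp_all add: k)
  \<comment> \<open>The last block of \<open>diag1 (Suc k)\<close> has coefficient
    \<open>jacobsthal 1 = 1\<close>.\<close>
  moreover have "scale (jacobsthal (Suc k - k)) (rho_iter k) = rho_iter k"
    by (simp add: jacobsthal_1 scale_def)
  ultimately show ?thesis
    unfolding diag1_def[of "Suc k"] rho_concat_Suc[OF assms] by simp
qed

section \<open>Induction on k\<close>

lemma scale_map2_add: "scale c (map2 (+) u v) = map2 (+) (scale c u) (scale c v)"
  by (simp add: scale_def zip_map_map o_def case_prod_unfold distrib_left)

lemma scale_map2_minus: "scale c (map2 (-) u v) = map2 (-) (scale c u) (scale c v)"
  by (simp add: scale_def zip_map_map o_def case_prod_unfold right_diff_distrib)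

lemma hadamard_conj_phi:
  assumes "k \<ge> 1"
  shows "hadamard k * phi1 k * hadamard k = diag (scale (2 ^ k) (diag1 k)) \<and>
    hadamard k * phi0 k * hadamard k = diag (scale (2 ^ (k + 1)) (diag0 k))"
  using assms
proof (induction k rule: dec_induct)
  case base
  \<comment> \<open>\<open>rho_concat\<close> always has two leading entries, so the 1 by 1 matrices
    do not fit it; the case \<open>k = 1\<close> comes from them by one block step.\<close>
  have "hadamard 0 * phi1 0 * hadamard 0 = diag [1]" "hadamard 0 * phi0 0 * hadamard 0 = diag [0]"
    by (auto intro!: eq_matI simp: diag_def mat_diag_def scalar_prod_def)
  from hadamard_conj_diag[OF phi_carrier this] hadamard_conj_diag[OF phi_carrier(1,1) this(1,1)]
  show ?case
    by (simp add: diag1_def diag0_def rho_concat_1 scale_def jacobsthal_def power2_eq_square)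
next
  case (step k)
  from step.IH have IH: "hadamard k * phi1 k * hadamard k = diag (scale (2 ^ k) (diag1 k))"
    "hadamard k * phi0 k * hadamard k = diag (scale (2 ^ (k + 1)) (diag0 k))"
    by blast+
  \<comment> \<open>Pulling \<open>2 ^ Suc k\<close> out leaves \<open>diag1 k\<close> and
    \<open>scale 2 (diag0 k)\<close>, as in \<open>diag1_Suc\<close>.\<close>
  have "scale 2 (map2 (+) (scale (2 ^ k) (diag1 k)) (scale (2 ^ (k + 1)) (diag0 k)))
      @ scale 2 (map2 (-) (scale (2 ^ k) (diag1 k)) (scale (2 ^ (k + 1)) (diag0 k)))
    = scale (2 ^ Suc k) (diag1 (Suc k))"
    using step.hyps
    by (simp add: diag1_Suc scale_append scale_map2_add scale_map2_minus scale_scale mult.commute)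
  \<comment> \<open>This is the block step with \<open>A = B = phi1 k\<close>: the sum is
    \<open>2 ^ (k + 2)\<close> times \<open>diag1 k\<close>, and the difference is zero.\<close>
  moreover have "scale 2 (map2 (+) (scale (2 ^ k) (diag1 k)) (scale (2 ^ k) (diag1 k)))
      @ scale 2 (map2 (-) (scale (2 ^ k) (diag1 k)) (scale (2 ^ k) (diag1 k)))
    = scale (2 ^ (Suc k + 1)) (diag0 (Suc k))"
    using step.hyps
    by (simp add: diag0_Suc scale_append map2_add_scale map2_minus_scale scale_scale mult.commute)
      (simp add: diag1_def scale_rho_concat flip: rho_concat_zero)
  ultimately show ?case
    using hadamard_conj_diag[OF phi_carrier IH] hadamard_conj_diag[OF phi_carrier(1,1) IH(1,1)]
    by (simp only: phi1.simps phi0.simps)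
qed

theorem theorem3:
  fixes k :: nat
  assumes "k \<ge> 1"
  shows "hadamard k * phi1 k * hadamard k =
      2 ^ k \<cdot>\<^sub>m diag ([jacobsthal (k + 1), jacobsthal k] @
        concat (map (\<lambda>m. scale (jacobsthal (k - m)) (rho_iter m)) [1..<k]))
    \<and> hadamard k * phi0 k * hadamard k =
      2 ^ (k + 1) \<cdot>\<^sub>m diag ([jacobsthal k, jacobsthal (k - 1)] @
        concat (map (\<lambda>m. scale (jacobsthal (k - 1 - m)) (rho_iter m)) [1..<k]))"
  using hadamard_conj_phi[OF assms]
  unfolding diag1_def diag0_def rho_concat_def smult_diag .

end
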